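(* Let $M$ be an ENH-manifold and let $\kappa\ge\omega_1$ be a cardinal. Let $A\subset U\subset M$ with $U$ open Hausdorff and $A$ $\kappa$-Baire in $M$ (e.g. $A=U$ nonempty and $\kappa=\mathrm{cov}(\mathcal{B})$). Let $S$ be a scan of $A$ in $M$. Then $S$ neither (i) is $\omega_1$-Lindelöf, nor (ii) can be covered by fewer than $\kappa$ many Hausdorff open subsets of $M$.
   Context: A manifold is a connected (in particular nonempty) topological space each of whose points has a neighborhood homeomorphic to $\mathbb{R}^n$ for some fixed integer $n$ (not assumed Hausdorff). Two points are separated if they have disjoint open neighborhoods; $NH(x)$ is the set of points $y\neq x$ of $M$ which cannot be separated from $x$, and $NH(A)=\bigcup_{x\in A}NH(x)$. An ENH-manifold is a manifold with $NH(x)\neq\varnothing$ for every point $x$. $A$ is $\kappa$-Baire in $M$ if it cannot be covered by fewer than $\kappa$ nowhere dense subsets of $M$. If $Y\cap NH(Y)=\varnothing$ (automatic when $Y$ is contained in an open Hausdorff set), a scan of $Y$ in $M$ is a subset $S\subset NH(Y)$ such that for each $x\in Y$: $NH(x)\neq\varnothing$ iff $NH(x)\cap S\neq\varnothing$. A space is $\omega_1$-Lindelöf if every cover by at most $\omega_1$ open sets has a countable subcover. $\mathrm{cov}(\mathcal{B})$ is the smallest cardinal $\mu$ such that $\mathbb{R}^n$ ($1\le n<\omega$) can be covered by at most $\mu$ nowhere dense subsets (it does not depend on $n$). *)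

theory Defs
  imports "HOL-Analysis.Analysis"
begin

unbundle cardinal_syntax

(* Not assumed Hausdorff, nor second countable. *)
definition manifold :: "'a topology \<Rightarrow> bool" where
  "manifold M \<longleftrightarrow> topspace M \<noteq> {} \<and> connected_space M \<and>
     (\<exists>n. \<forall>x\<in>topspace M. \<exists>V N. openin M V \<and> x \<in> V \<and> V \<subseteq> N \<and> N \<subseteq> topspace M \<and>
        subtopology M N homeomorphic_space Euclidean_space n)"

definition separated_points :: "'a topology \<Rightarrow> 'a \<Rightarrow> 'a \<Rightarrow> bool" where
  "separated_points M x y \<longleftrightarrow>
     (\<exists>V W. openin M V \<and> openin M W \<and> x \<in> V \<and> y \<in> W \<and> disjnt V W)"

definition NH :: "'a topology \<Rightarrow> 'a \<Rightarrow> 'a set" where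
  "NH M x = {y \<in> topspace M. y \<noteq> x \<and> \<not> separated_points M x y}"

definition NH_set :: "'a topology \<Rightarrow> 'a set \<Rightarrow> 'a set" where
  "NH_set M A = (\<Union>x\<in>A. NH M x)"

definition ENH_manifold :: "'a topology \<Rightarrow> bool" where
  "ENH_manifold M \<longleftrightarrow> manifold M \<and> (\<forall>x\<in>topspace M. NH M x \<noteq> {})"

definition open_Hausdorff_in :: "'a topology \<Rightarrow> 'a set \<Rightarrow> bool" where
  "open_Hausdorff_in M U \<longleftrightarrow> openin M U \<and> Hausdorff_space (subtopology M U)"

definition nowhere_dense_in :: "'a topology \<Rightarrow> 'a set \<Rightarrow> bool" where
  "nowhere_dense_in X N \<longleftrightarrow> N \<subseteq> topspace X \<and> X interior_of (X closure_of N) = {}"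

definition Baire_in :: "'k rel \<Rightarrow> 'a topology \<Rightarrow> 'a set \<Rightarrow> bool" where
  "Baire_in \<kappa> M A \<longleftrightarrow>
     \<not> (\<exists>\<F>. |\<F>| <o \<kappa> \<and> (\<forall>N\<in>\<F>. nowhere_dense_in M N) \<and> A \<subseteq> \<Union>\<F>)"

definition scan :: "'a topology \<Rightarrow> 'a set \<Rightarrow> 'a set \<Rightarrow> bool" where
  "scan M Y S \<longleftrightarrow> Y \<subseteq> topspace M \<and> Y \<inter> NH_set M Y = {} \<and> S \<subseteq> NH_set M Y \<and>
     (\<forall>x\<in>Y. NH M x \<noteq> {} \<longleftrightarrow> NH M x \<inter> S \<noteq> {})"

abbreviation omega1 :: "nat set rel" where
  "omega1 \<equiv> cardSuc natLeq"

definition omega1_Lindelof_space :: "'a topology \<Rightarrow> bool" where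
  "omega1_Lindelof_space X \<longleftrightarrow>
     (\<forall>\<U>. |\<U>| \<le>o omega1 \<and> (\<forall>U\<in>\<U>. openin X U) \<and> \<Union>\<U> = topspace X
        \<longrightarrow> (\<exists>\<V>. countable \<V> \<and> \<V> \<subseteq> \<U> \<and> \<Union>\<V> = topspace X))"

definition nowhere_dense_cover :: "'a topology \<Rightarrow> 'a set set \<Rightarrow> bool" where
  "nowhere_dense_cover X \<F> \<longleftrightarrow> (\<forall>N\<in>\<F>. nowhere_dense_in X N) \<and> \<Union>\<F> = topspace X"

(* The value for n = 0 is meaningless: the one-point space has no nowhere dense cover.
   The dimension is a parameter so that independence of n is not built in. *)
definition cov_B :: "nat \<Rightarrow> (nat \<Rightarrow> real) set rel" where
  "cov_B n = |SOME \<F>. nowhere_dense_cover (Euclidean_space n) \<F> \<and>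
     (\<forall>\<G>. nowhere_dense_cover (Euclidean_space n) \<G> \<longrightarrow> |\<F>| \<le>o |\<G>| )|"

(* The disjointness required in the definition of a scan is automatic inside an open Hausdorff set. *)
lemma disjoint_NH_set_of_open_Hausdorff:
  assumes "open_Hausdorff_in M U" "Y \<subseteq> U"
  shows "Y \<inter> NH_set M Y = {}"
proof -
  have "separated_points M x y" if "x \<in> U" "y \<in> U" "x \<noteq> y" for x y
  proof -
    have U: "openin M U" "Hausdorff_space (subtopology M U)"
      using assms(1) by (auto simp: open_Hausdorff_in_def)
    have "x \<in> topspace (subtopology M U)" "y \<in> topspace (subtopology M U)"
      using that openin_subset[OF U(1)] by auto
    then obtain V W where "openin (subtopology M U) V" "openin (subtopology M U) W"
        "x \<in> V" "y \<in> W" "disjnt V W"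
      using U(2) \<open>x \<noteq> y\<close> unfolding Hausdorff_space_def by blast
    then show ?thesis
      unfolding separated_points_def using openin_open_subtopology[OF U(1)] by blast
  qed
  then show ?thesis
    using assms(2) unfolding NH_set_def NH_def by blast
qed

lemma nowhere_dense_cover_exists:
  assumes "1 \<le> n"
  shows "\<exists>\<F>. nowhere_dense_cover (Euclidean_space n) \<F>"
proof -
  let ?E = "Euclidean_space n"
  have "nowhere_dense_in ?E {x}" if x: "x \<in> topspace ?E" for x
  proof -
    have haus: "Hausdorff_space ?E"
      unfolding Euclidean_space_def
      by (intro Hausdorff_space_subtopology) (simp add: Hausdorff_space_product_topology)
    then have "?E closure_of {x} = {x}"
      using x by (simp add: closure_of_eq closedin_Hausdorff_singleton)
    moreover have "\<not> openin ?E {x}"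
    proof
      assume op: "openin ?E {x}"
      define f :: "real \<Rightarrow> nat \<Rightarrow> real" where "f t = (\<lambda>i. if i = 0 then x i + t else x i)" for t
      have "continuous_map euclideanreal (powertop_real UNIV) f"
        unfolding continuous_map_componentwise_UNIV f_def
        by (auto intro!: continuous_intros)
      then have "continuous_map euclideanreal ?E f"
        using x assms
        unfolding Euclidean_space_def
        by (auto simp: continuous_map_in_subtopology f_def)
      then have "openin euclideanreal {t \<in> topspace euclideanreal. f t \<in> {x}}"
        using op by (rule openin_continuous_map_preimage)
      moreover have "f t = x \<longleftrightarrow> t = 0" for t
        by (auto simp: f_def fun_eq_iff)
      ultimately have "open {0::real}" by simp
      then show False by (simp add: not_open_singleton)
    qed
    then have "?E interior_of {x} = {}"
      by (metis interior_of_subset openin_interior_of subset_singletonD)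
    ultimately show ?thesis
      using x by (simp add: nowhere_dense_in_def)
  qed
  then have "nowhere_dense_cover ?E ((\<lambda>x. {x}) ` topspace ?E)"
    by (auto simp: nowhere_dense_cover_def)
  then show ?thesis ..
qed

lemma cov_B_least:
  assumes "1 \<le> n"
  shows "\<exists>\<F>. nowhere_dense_cover (Euclidean_space n) \<F> \<and> cov_B n = |\<F>|"
    and "nowhere_dense_cover (Euclidean_space n) \<G> \<Longrightarrow> cov_B n \<le>o |\<G>|"
proof -
  let ?P = "\<lambda>\<F>. nowhere_dense_cover (Euclidean_space n) \<F>"
  let ?R = "{|\<F>| | \<F>. ?P \<F>}"
  have "?R \<noteq> {}" using nowhere_dense_cover_exists[OF assms] by blast
  moreover have "\<forall>r\<in>?R. Card_order r" by (auto intro: card_of_Card_order)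
  ultimately obtain r where "r \<in> ?R" "\<forall>r'\<in>?R. r \<le>o r'"
    using exists_minim_Card_order[of ?R] by blast
  then have "\<exists>\<F>. ?P \<F> \<and> (\<forall>\<G>. ?P \<G> \<longrightarrow> |\<F>| \<le>o |\<G>| )" by blast
  from someI_ex[OF this]
  show "\<exists>\<F>. ?P \<F> \<and> cov_B n = |\<F>|" "?P \<G> \<Longrightarrow> cov_B n \<le>o |\<G>|"
    unfolding cov_B_def by blast+
qed

end

theory Submission
  imports Defs "HOL-Library.Countable_Set_Type"
begin

text \<open>
  A point that cannot be separated from some point of an open Hausdorff set \<open>W\<close> lies in the closure
  of \<open>W\<close> but not in \<open>W\<close>, so \<open>NH_set M W\<close> is contained in the frontier of an open set and is nowhere
  dense (\<open>NH_set_nowhere_dense\<close>). A cover \<open>\<W>\<close> of a scan \<open>S\<close> of \<open>A\<close> by open Hausdorff sets therefore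
  yields the cover of \<open>A\<close> by the nowhere dense sets \<open>NH_set M W\<close> with \<open>W \<in> \<W>\<close>: every \<open>x \<in> A\<close> has a
  companion in \<open>S\<close>, and being inseparable is a symmetric relation. As \<open>A\<close> is \<open>\<kappa>\<close>-Baire, \<open>\<W>\<close> has at
  least \<open>\<kappa>\<close> members (\<open>scan_not_covered\<close>).

  This also settles the Lindelof statement, because an \<open>\<omega>\<^sub>1\<close>-Lindelof space that is locally second
  countable is Lindelof (\<open>omega1_Lindelof_imp_Lindelof_space\<close>). Otherwise a recursion of length
  \<open>\<omega>\<^sub>1\<close> produces points \<open>y \<alpha>\<close> with open neighbourhoods that miss all later points. By the
  \<open>\<omega>\<^sub>1\<close>-Lindelof property the closures of the tails of this sequence share a point \<open>z\<close>, and a second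
  countable neighbourhood of \<open>z\<close> then contains uncountably many of the \<open>y \<alpha>\<close>, which is impossible in
  a hereditarily Lindelof space. A scan is locally second countable, so if it were
  \<open>\<omega>\<^sub>1\<close>-Lindelof, countably many charts, hence fewer than \<open>\<kappa>\<close>, would cover it.

  In the example \<open>A = U\<close> and \<open>\<kappa> = cov_B n\<close>, the dimension of \<open>M\<close> may differ from \<open>n\<close>, so it has to be
  shown that no Euclidean space of positive dimension has a cover by fewer than \<open>cov_B n\<close> nowhere
  dense sets. Preimages under a coordinate projection turn nowhere dense covers of the line into
  nowhere dense covers of \<open>\<real>\<^sup>n\<close>, so the line is \<open>cov_B n\<close>-Baire. From the line one climbs up the
  dimensions: by the Kuratowski--Ulam argument, the property that all nonempty open sets are
  \<open>\<kappa>\<close>-Baire passes from two spaces, one of them second countable, to their product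
  (\<open>open_Baire_prod_topology\<close>). Charts finally carry it to the manifold. The product argument and the
  passage from the line to its open subsets replace each set by countably many sets, which does no
  harm since \<open>\<kappa> \<ge> \<omega>\<^sub>1\<close>; that \<open>cov_B n\<close> is uncountable is the Baire category theorem.
\<close>

section \<open>Nowhere dense sets\<close>

text \<open>
  The form used below to move nowhere dense sets along maps: every nonempty open set can be shrunk
  to a nonempty open set that misses \<open>N\<close>.
\<close>

lemma nowhere_dense_in_iff:
  "nowhere_dense_in X N \<longleftrightarrow> N \<subseteq> topspace X \<and>
     (\<forall>P. openin X P \<and> P \<noteq> {} \<longrightarrow> (\<exists>Q. openin X Q \<and> Q \<noteq> {} \<and> Q \<subseteq> P \<and> Q \<inter> N = {}))"
proof (cases "N \<subseteq> topspace X")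
  case True
  have "X interior_of (X closure_of N) = {} \<longleftrightarrow>
     (\<forall>P. openin X P \<and> P \<noteq> {} \<longrightarrow> (\<exists>Q. openin X Q \<and> Q \<noteq> {} \<and> Q \<subseteq> P \<and> Q \<inter> N = {}))"
  proof
    assume L: "X interior_of (X closure_of N) = {}"
    show "\<forall>P. openin X P \<and> P \<noteq> {} \<longrightarrow> (\<exists>Q. openin X Q \<and> Q \<noteq> {} \<and> Q \<subseteq> P \<and> Q \<inter> N = {})"
    proof (intro allI impI)
      fix P assume P: "openin X P \<and> P \<noteq> {}"
      have "P - X closure_of N \<noteq> {}"
        using L P unfolding interior_of_eq_empty_alt by blast
      moreover have "openin X (P - X closure_of N)"
        using P by (intro openin_diff) auto
      moreover have "(P - X closure_of N) \<inter> N = {}"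
        using closure_of_subset[OF True] by blast
      ultimately show "\<exists>Q. openin X Q \<and> Q \<noteq> {} \<and> Q \<subseteq> P \<and> Q \<inter> N = {}"
        by blast
    qed
  next
    assume R: "\<forall>P. openin X P \<and> P \<noteq> {} \<longrightarrow> (\<exists>Q. openin X Q \<and> Q \<noteq> {} \<and> Q \<subseteq> P \<and> Q \<inter> N = {})"
    show "X interior_of (X closure_of N) = {}"
      unfolding interior_of_eq_empty_alt
    proof (intro allI impI)
      fix P assume "openin X P \<and> P \<noteq> {}"
      then obtain Q where Q: "openin X Q" "Q \<noteq> {}" "Q \<subseteq> P" "Q \<inter> N = {}"
        using R by blast
      then have "Q \<inter> X closure_of N = {}"
        using openin_Int_closure_of_eq_empty by metis
      with Q show "P - X closure_of N \<noteq> {}" by blast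
    qed
  qed
  with True show ?thesis by (simp add: nowhere_dense_in_def)
qed (auto simp: nowhere_dense_in_def)

lemma nowhere_dense_in_closure_of:
  assumes "nowhere_dense_in X N"
  shows "nowhere_dense_in X (X closure_of N)"
  using assms by (simp add: nowhere_dense_in_def closure_of_subset_topspace)

lemma nowhere_dense_in_subset:
  assumes "nowhere_dense_in X N" "K \<subseteq> N"
  shows "nowhere_dense_in X K"
proof -
  have "X interior_of (X closure_of K) \<subseteq> X interior_of (X closure_of N)"
    using assms(2) by (intro interior_of_mono closure_of_mono)
  then show ?thesis using assms by (auto simp: nowhere_dense_in_def)
qed

lemma nowhere_dense_in_frontier_of_open:
  assumes "openin X W"
  shows "nowhere_dense_in X (X closure_of W - W)"
  unfolding nowhere_dense_in_iff
proof (intro conjI allI impI)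
  show "X closure_of W - W \<subseteq> topspace X"
    using closure_of_subset_topspace by fastforce
  fix P assume P: "openin X P \<and> P \<noteq> {}"
  show "\<exists>Q. openin X Q \<and> Q \<noteq> {} \<and> Q \<subseteq> P \<and> Q \<inter> (X closure_of W - W) = {}"
  proof (cases "P \<inter> W = {}")
    case True
    then have "P \<inter> X closure_of W = {}"
      using P openin_Int_closure_of_eq_empty by metis
    with P show ?thesis by blast
  next
    case False
    with P assms show ?thesis by (intro exI[of _ "P \<inter> W"]) auto
  qed
qed

section \<open>Inseparable points and scans\<close>

text \<open>
  Two points of a Hausdorff open set are separated, so \<open>NH_set M W\<close> misses \<open>W\<close>; on the other hand a
  point outside the closure of \<open>W\<close> is separated by \<open>W\<close> itself from all points of \<open>W\<close>.
\<close>

lemma NH_set_nowhere_dense: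
  assumes "open_Hausdorff_in M W"
  shows "nowhere_dense_in M (NH_set M W)"
proof -
  have W: "openin M W"
    using assms by (simp add: open_Hausdorff_in_def)
  have "x \<in> M closure_of W - W" if x: "x \<in> NH_set M W" for x
  proof -
    obtain y where y: "y \<in> W" "x \<in> topspace M" "\<not> separated_points M y x"
      using x by (auto simp: NH_set_def NH_def)
    have "\<exists>z. z \<in> W \<and> z \<in> T" if T: "x \<in> T" "openin M T" for T
    proof -
      have "\<not> disjnt W T"
        using y T W unfolding separated_points_def by blast
      then show ?thesis by (auto simp: disjnt_iff)
    qed
    then have "x \<in> M closure_of W"
      using y by (simp add: in_closure_of)
    moreover have "x \<notin> W"
      using x disjoint_NH_set_of_open_Hausdorff[OF assms order_refl] by blast
    ultimately show ?thesis by blast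
  qed
  then have "NH_set M W \<subseteq> M closure_of W - W" by blast
  with nowhere_dense_in_frontier_of_open[OF W] show ?thesis by (rule nowhere_dense_in_subset)
qed

lemma NH_commute: "x \<in> topspace M \<Longrightarrow> y \<in> NH M x \<Longrightarrow> x \<in> NH M y"
  unfolding NH_def separated_points_def using disjnt_sym by blast

lemma scan_not_covered:
  assumes NH: "\<And>x. x \<in> topspace M \<Longrightarrow> NH M x \<noteq> {}"
    and A: "Baire_in \<kappa> M A" and S: "scan M A S"
    and W: "|\<W>| <o \<kappa>" "\<And>W. W \<in> \<W> \<Longrightarrow> open_Hausdorff_in M W"
  shows "\<not> S \<subseteq> \<Union>\<W>"
proof
  assume cov: "S \<subseteq> \<Union>\<W>"
  have "A \<subseteq> \<Union>(NH_set M ` \<W>)"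
  proof
    fix x assume x: "x \<in> A"
    then have xM: "x \<in> topspace M" using S by (auto simp: scan_def)
    have "NH M x \<inter> S \<noteq> {}" using x S NH[OF xM] by (simp add: scan_def)
    then obtain y where y: "y \<in> NH M x" "y \<in> S" by blast
    then obtain W where "W \<in> \<W>" "y \<in> W" using cov by blast
    moreover have "x \<in> NH M y" using NH_commute xM y(1) by fast
    ultimately show "x \<in> \<Union>(NH_set M ` \<W>)" by (auto simp: NH_set_def)
  qed
  moreover have "|NH_set M ` \<W>| <o \<kappa>"
    using card_of_image W(1) by (rule ordLeq_ordLess_trans)
  ultimately show False
    using A NH_set_nowhere_dense[OF W(2)] unfolding Baire_in_def by blast
qed

section \<open>Countable sets and the first uncountable cardinal\<close>

lemma countable_ordLess:
  assumes "omega1 \<le>o \<kappa>" "countable C"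
  shows "|C| <o \<kappa>"
proof -
  have "|C| \<le>o natLeq" using assms(2) by (simp add: countable_card_le_natLeq)
  also have "natLeq <o omega1" by (simp add: cardSuc_greater natLeq_Card_order)
  finally (ordLeq_ordLess_trans) show ?thesis using assms(1) by (rule ordLess_ordLeq_trans)
qed

text \<open>
  If \<open>I\<close> is infinite the union has at most as many elements as \<open>I\<close>, and if \<open>I\<close> is countable the
  union is countable.
\<close>

lemma card_of_UN_countable_ordLess:
  assumes "omega1 \<le>o \<kappa>" "|I| <o \<kappa>" "\<And>i. i \<in> I \<Longrightarrow> countable (A i)"
  shows "|\<Union>i\<in>I. A i| <o \<kappa>"
proof (cases "countable I")
  case True
  then show ?thesis
    using assms by (intro countable_ordLess) auto
next
  case False
  then have inf: "infinite I" using countable_finite by blast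
  have "|A i| \<le>o |I|" if "i \<in> I" for i
    using assms(3)[OF that] inf by (meson countable_card_of_nat infinite_iff_card_of_nat ordLeq_transitive)
  then have "|\<Union>i\<in>I. A i| \<le>o |I|"
    using inf by (intro card_of_UNION_ordLeq_infinite) (auto simp: ordLeq_refl card_of_Card_order)
  then show ?thesis using assms(2) by (rule ordLeq_ordLess_trans)
qed

lemma omega1_Card_order: "Card_order omega1"
  by (simp add: cardSuc_Card_order natLeq_Card_order)

lemma omega1_Well_order: "Well_order omega1"
  using omega1_Card_order unfolding card_order_on_def by blast

lemma countable_if_ordLess_omega1:
  assumes "|C| <o omega1"
  shows "countable C"
  using assms cardSuc_ordLeq_ordLess[OF natLeq_Card_order, of "|C|"]
  by (simp add: countable_card_le_natLeq card_of_Card_order)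

lemma countable_omega1_predecessors: "countable {\<beta>. (\<beta>, \<alpha>) \<in> omega1 - Id}"
proof (cases "\<alpha> \<in> Field omega1")
  case True
  have "{\<beta>. (\<beta>, \<alpha>) \<in> omega1 - Id} = underS omega1 \<alpha>"
    by (auto simp: underS_def)
  then show ?thesis
    using countable_if_ordLess_omega1[OF card_of_underS[OF omega1_Card_order True]] by simp
next
  case False
  then have "{\<beta>. (\<beta>, \<alpha>) \<in> omega1 - Id} = {}" by (auto simp: Field_def)
  then show ?thesis by (simp only: countable_empty)
qed

text \<open>
  The elements of \<open>C\<close> and their predecessors form a countable set, which cannot be all of \<open>\<omega>\<^sub>1\<close>.
\<close>

lemma countable_subset_omega1_bounded:
  assumes "countable C"
  obtains \<gamma> where "\<gamma> \<in> Field omega1" "\<And>\<alpha>. \<alpha> \<in> C \<inter> Field omega1 \<Longrightarrow> (\<alpha>, \<gamma>) \<in> omega1 - Id"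
proof -
  let ?D = "C \<union> (\<Union>\<alpha>\<in>C. {\<beta>. (\<beta>, \<alpha>) \<in> omega1 - Id})"
  have "countable ?D"
    using assms countable_omega1_predecessors by blast
  then have "|?D| <o omega1"
    using omega1_Card_order by (intro countable_ordLess) (simp_all add: ordLeq_refl)
  moreover have "|Field omega1| =o omega1"
    by (rule card_of_Field_ordIso[OF omega1_Card_order])
  ultimately have "\<not> Field omega1 \<subseteq> ?D"
    using card_of_mono1 not_ordLess_ordIso ordLeq_ordLess_trans by metis
  then obtain \<gamma> where \<gamma>: "\<gamma> \<in> Field omega1" "\<gamma> \<notin> ?D" by blast
  have "(\<alpha>, \<gamma>) \<in> omega1 - Id" if "\<alpha> \<in> C \<inter> Field omega1" for \<alpha>
  proof -
    have "\<alpha> \<noteq> \<gamma>" "(\<gamma>, \<alpha>) \<notin> omega1" using \<gamma> that by auto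
    moreover have "total_on (Field omega1) omega1"
      using omega1_Well_order by (simp add: order_on_defs)
    ultimately show ?thesis
      using \<gamma>(1) that by (auto simp: total_on_def)
  qed
  with \<gamma>(1) show thesis by (rule that)
qed

section \<open>Locally second countable spaces\<close>

text \<open>
  From an open cover without countable subcover one extracts a right-separated sequence of length
  \<open>\<omega>\<^sub>1\<close>. It accumulates at some point because of the \<open>\<omega>\<^sub>1\<close>-Lindelof property, whereas a second
  countable neighbourhood of that point cannot contain an uncountable right-separated set.
\<close>

lemma omega1_Lindelof_imp_Lindelof_space:
  assumes lind: "omega1_Lindelof_space X"
    and loc: "\<And>x. x \<in> topspace X \<Longrightarrow> \<exists>V. openin X V \<and> x \<in> V \<and> second_countable (subtopology X V)"
  shows "Lindelof_space X"
proof (rule ccontr)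
  assume "\<not> Lindelof_space X"
  then obtain \<U> where \<U>: "\<And>U. U \<in> \<U> \<Longrightarrow> openin X U" "\<Union>\<U> = topspace X"
    and nocov: "\<And>\<V>. countable \<V> \<Longrightarrow> \<V> \<subseteq> \<U> \<Longrightarrow> \<Union>\<V> \<noteq> topspace X"
    unfolding Lindelof_space_def by metis
  obtain u where u: "\<And>x. x \<in> topspace X \<Longrightarrow> u x \<in> \<U> \<and> x \<in> u x"
  proof -
    have "\<forall>x. \<exists>U. x \<in> topspace X \<longrightarrow> U \<in> \<U> \<and> x \<in> U" using \<U>(2) by blast
    then show thesis using that by metis
  qed
  define R where "R = omega1 - Id"
  \<comment> \<open>The requirement on the next point: it avoids the neighbourhoods chosen for all earlier ones.\<close>
  define P where "P = (\<lambda>(f :: nat set \<Rightarrow> 'a) \<alpha> x. x \<in> topspace X \<and> (\<forall>\<beta>. (\<beta>, \<alpha>) \<in> R \<longrightarrow> x \<notin> u (f \<beta>)))"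
  have "wf R"
    using omega1_Well_order unfolding R_def well_order_on_def by blast
  then have "\<exists>f. \<forall>\<alpha>. P f \<alpha> (f \<alpha>)"
  proof (rule dependent_wf_choice[where P = P])
    show "P f \<alpha> x = P g \<alpha> x" if "\<And>z. (z, \<alpha>) \<in> R \<Longrightarrow> f z = g z" for f g \<alpha> x
      using that by (auto simp: P_def)
    show "\<exists>x. P f \<alpha> x" if f: "\<And>\<beta>. (\<beta>, \<alpha>) \<in> R \<Longrightarrow> P f \<beta> (f \<beta>)" for f \<alpha>
    proof -
      let ?V = "(\<lambda>\<beta>. u (f \<beta>)) ` {\<beta>. (\<beta>, \<alpha>) \<in> R}"
      have "countable ?V"
        using countable_omega1_predecessors unfolding R_def by blast
      moreover have sub: "?V \<subseteq> \<U>" using f u by (auto simp: P_def)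
      ultimately have "\<Union>?V \<noteq> topspace X" by (rule nocov)
      moreover have "\<Union>?V \<subseteq> topspace X" using sub \<U>(2) by blast
      ultimately obtain x where "x \<in> topspace X" "x \<notin> \<Union>?V" by blast
      then show ?thesis unfolding P_def by blast
    qed
  qed
  then obtain y where y: "\<And>\<alpha>. y \<alpha> \<in> topspace X" "\<And>\<alpha> \<beta>. (\<beta>, \<alpha>) \<in> R \<Longrightarrow> y \<alpha> \<notin> u (y \<beta>)"
    unfolding P_def by blast
  define tail where "tail \<alpha> = y ` {\<beta>. (\<alpha>, \<beta>) \<in> omega1}" for \<alpha>
  define off where "off \<alpha> = topspace X - X closure_of (tail \<alpha>)" for \<alpha>
  have tail_sub: "tail \<alpha> \<subseteq> X closure_of (tail \<alpha>)" for \<alpha>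
    using y(1) by (intro closure_of_subset) (auto simp: tail_def)
  have small: "|off ` Field omega1| \<le>o omega1"
    using card_of_image[of off "Field omega1"] card_of_Field_ordIso[OF omega1_Card_order]
    by (rule ordLeq_ordIso_trans)
  \<comment> \<open>The tails decrease, so countably many of these complements still miss a whole tail.\<close>
  have "\<Union>(off ` Field omega1) \<noteq> topspace X"
  proof
    assume "\<Union>(off ` Field omega1) = topspace X"
    moreover have "\<forall>U\<in>off ` Field omega1. openin X U"
      by (auto simp: off_def intro!: openin_diff)
    ultimately obtain \<V> where "countable \<V>" "\<V> \<subseteq> off ` Field omega1" "\<Union>\<V> = topspace X"
      using lind[unfolded omega1_Lindelof_space_def, rule_format, of "off ` Field omega1"] small
      by metis
    then obtain C where C: "countable C" "C \<subseteq> Field omega1" "\<Union>(off ` C) = topspace X"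
      by (metis countable_subset_image)
    obtain \<gamma> where \<gamma>: "\<And>\<alpha>. \<alpha> \<in> C \<inter> Field omega1 \<Longrightarrow> (\<alpha>, \<gamma>) \<in> omega1 - Id"
      using countable_subset_omega1_bounded[OF C(1)] by metis
    have "y \<gamma> \<notin> off \<alpha>" if "\<alpha> \<in> C" for \<alpha>
      using tail_sub[of \<alpha>] \<gamma>[of \<alpha>] that C(2) by (auto simp: tail_def off_def)
    then show False using C(3) y(1) by blast
  qed
  moreover have "\<Union>(off ` Field omega1) \<subseteq> topspace X" by (auto simp: off_def)
  ultimately obtain z where z: "z \<in> topspace X" "\<And>\<alpha>. \<alpha> \<in> Field omega1 \<Longrightarrow> z \<in> X closure_of (tail \<alpha>)"
    unfolding off_def by blast
  obtain V where V: "openin X V" "z \<in> V" "second_countable (subtopology X V)"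
    using loc z(1) by blast
  define I where "I = {\<beta> \<in> Field omega1. y \<beta> \<in> V}"
  \<comment> \<open>Second countability is hereditary, so the terms of the sequence inside \<open>V\<close> form a Lindelof space.\<close>
  have "Lindelof_space (subtopology X (y ` I))"
  proof -
    have "subtopology X (y ` I) = subtopology (subtopology X V) (y ` I)"
      by (auto simp: I_def subtopology_subtopology intro!: arg_cong[where f = "subtopology X"])
    then show ?thesis
      using V(3) by (simp add: second_countable_subtopology second_countable_imp_Lindelof_space)
  qed
  moreover have "topspace (subtopology X (y ` I)) = y ` I"
    using y(1) by auto
  moreover have "\<And>U. U \<in> (\<lambda>\<beta>. u (y \<beta>) \<inter> y ` I) ` I \<Longrightarrow> openin (subtopology X (y ` I)) U"
    using u y(1) \<U>(1) by (auto simp: openin_subtopology)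
  moreover have "\<Union>((\<lambda>\<beta>. u (y \<beta>) \<inter> y ` I) ` I) = y ` I"
    using u y(1) by blast
  ultimately obtain \<V> where "countable \<V>" "\<V> \<subseteq> (\<lambda>\<beta>. u (y \<beta>) \<inter> y ` I) ` I" "\<Union>\<V> = y ` I"
    unfolding Lindelof_space_def by metis
  then obtain C where C: "countable C" "C \<subseteq> I" "(\<Union>\<beta>\<in>C. u (y \<beta>) \<inter> y ` I) = y ` I"
    by (metis countable_subset_image)
  obtain \<gamma> where \<gamma>: "\<gamma> \<in> Field omega1" "\<And>\<alpha>. \<alpha> \<in> C \<Longrightarrow> (\<alpha>, \<gamma>) \<in> R"
    using countable_subset_omega1_bounded[OF C(1)] C(2) unfolding R_def I_def
    by (metis (no_types, lifting) IntI mem_Collect_eq subsetD)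
  \<comment> \<open>A term beyond \<open>\<gamma>\<close> that lies in \<open>V\<close> is in no \<open>u (y \<delta>)\<close> with \<open>\<delta> \<in> C\<close>, yet these sets cover \<open>y ` I\<close>.\<close>
  have "z \<in> X closure_of (tail \<gamma>)" using z(2) \<gamma>(1) .
  then obtain \<beta> where \<beta>: "(\<gamma>, \<beta>) \<in> omega1" "y \<beta> \<in> V"
    using V(1,2) unfolding in_closure_of tail_def by blast
  then have "\<beta> \<in> I" by (auto simp: I_def Field_def)
  then obtain \<delta> where \<delta>: "\<delta> \<in> C" "y \<beta> \<in> u (y \<delta>)" using C(3) by blast
  have "(\<delta>, \<beta>) \<in> R"
  proof -
    have "trans omega1" "antisym omega1"
      using omega1_Well_order by (simp_all add: order_on_defs)
    then show ?thesis
      using \<gamma>(2)[OF \<delta>(1)] \<beta>(1) unfolding R_def trans_def antisym_def by blast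
  qed
  with y(2) \<delta>(2) show False by blast
qed

section \<open>Spaces all of whose nonempty open sets are \<open>\<kappa>\<close>-Baire\<close>

definition open_Baire :: "'k rel \<Rightarrow> 'a topology \<Rightarrow> bool" where
  "open_Baire \<kappa> X \<longleftrightarrow> (\<forall>P. openin X P \<and> P \<noteq> {} \<longrightarrow> Baire_in \<kappa> X P)"

lemma Baire_in_mono: "Baire_in \<kappa> X A \<Longrightarrow> A \<subseteq> B \<Longrightarrow> Baire_in \<kappa> X B"
  unfolding Baire_in_def by (meson order_trans)

lemma Baire_in_image:
  assumes A: "Baire_in \<kappa> Y B" and B: "B \<subseteq> h ` A"
    and nd: "\<And>N. nowhere_dense_in X N \<Longrightarrow> nowhere_dense_in Y (h ` (N \<inter> A))"
  shows "Baire_in \<kappa> X A"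
  unfolding Baire_in_def
proof
  assume "\<exists>\<F>. |\<F>| <o \<kappa> \<and> (\<forall>N\<in>\<F>. nowhere_dense_in X N) \<and> A \<subseteq> \<Union>\<F>"
  then obtain \<F> where F: "|\<F>| <o \<kappa>" "\<forall>N\<in>\<F>. nowhere_dense_in X N" "A \<subseteq> \<Union>\<F>" by blast
  let ?G = "(\<lambda>N. h ` (N \<inter> A)) ` \<F>"
  have "|?G| <o \<kappa>" using card_of_image F(1) by (rule ordLeq_ordLess_trans)
  moreover have "\<forall>N\<in>?G. nowhere_dense_in Y N" using F(2) nd by blast
  moreover have "B \<subseteq> \<Union>?G"
  proof
    fix b assume "b \<in> B"
    then obtain a where a: "a \<in> A" "b = h a" using B by blast
    then obtain N where "N \<in> \<F>" "a \<in> N" using F(3) by blast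
    with a show "b \<in> \<Union>?G" by blast
  qed
  ultimately show False using A unfolding Baire_in_def by blast
qed

text \<open>
  A chart with domain \<open>N\<close> matches open sets of \<open>Y\<close> only with relatively open subsets of \<open>N\<close>. Inside
  the open set \<open>W\<close>, these are the open sets of \<open>M\<close>, so nowhere dense sets can be transported there.
\<close>

lemma Baire_in_open_chart:
  assumes hom: "homeomorphic_map (subtopology M N) Y h" and Y: "open_Baire \<kappa> Y"
    and W: "openin M W" "W \<subseteq> N" "W \<noteq> {}"
  shows "Baire_in \<kappa> M W"
proof -
  have WM: "W \<subseteq> topspace M" using W(1) by (rule openin_subset)
  have op: "openin Y (h ` Q) \<longleftrightarrow> openin M Q" if "Q \<subseteq> W" for Q
  proof -
    have "openin Y (h ` Q) \<longleftrightarrow> openin (subtopology M N) Q"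
      using WM W(2) that by (intro homeomorphic_map_openness[OF hom]) auto
    also have "\<dots> \<longleftrightarrow> openin M Q"
    proof
      assume "openin (subtopology M N) Q"
      then obtain T where T: "openin M T" "Q = T \<inter> N" by (auto simp: openin_subtopology)
      then have "Q = T \<inter> W" using that W(2) by blast
      with T(1) W(1) show "openin M Q" by auto
    next
      assume "openin M Q"
      then show "openin (subtopology M N) Q"
        using that W(2) by (auto simp: openin_subtopology)
    qed
    finally show ?thesis .
  qed
  show ?thesis
  proof (rule Baire_in_image)
    show "Baire_in \<kappa> Y (h ` W)"
      using Y op[OF order_refl] W unfolding open_Baire_def by blast
    show "h ` W \<subseteq> h ` W" ..
    fix F assume F: "nowhere_dense_in M F"
    show "nowhere_dense_in Y (h ` (F \<inter> W))"
      unfolding nowhere_dense_in_iff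
    proof (intro conjI allI impI)
      show "h ` (F \<inter> W) \<subseteq> topspace Y"
        using op[OF order_refl] W(1) openin_subset by blast
      fix P assume P: "openin Y P \<and> P \<noteq> {}"
      show "\<exists>Q. openin Y Q \<and> Q \<noteq> {} \<and> Q \<subseteq> P \<and> Q \<inter> h ` (F \<inter> W) = {}"
      proof (cases "P \<inter> h ` W = {}")
        case True
        with P show ?thesis by blast
      next
        case False
        define P' where "P' = {x \<in> W. h x \<in> P}"
        have "h ` P' = P \<inter> h ` W" by (auto simp: P'_def)
        moreover have "openin Y (P \<inter> h ` W)"
          using P op[OF order_refl] W(1) by auto
        ultimately have "openin M P'" using op[of P'] by (auto simp: P'_def)
        moreover have "P' \<noteq> {}" using False by (auto simp: P'_def)
        ultimately obtain Q where Q: "openin M Q" "Q \<noteq> {}" "Q \<subseteq> P'" "Q \<inter> F = {}"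
          using F unfolding nowhere_dense_in_iff by blast
        have inj: "inj_on h W"
          using homeomorphic_imp_injective_map[OF hom] WM W(2)
          by (auto intro: inj_on_subset)
        have QW: "Q \<subseteq> W" using Q(3) by (auto simp: P'_def)
        have "h ` Q \<inter> h ` (F \<inter> W) = h ` (Q \<inter> (F \<inter> W))"
          using QW by (intro inj_on_image_Int[OF inj, symmetric]) auto
        then show ?thesis
          using Q QW op[OF QW] by (intro exI[of _ "h ` Q"]) (auto simp: P'_def)
      qed
    qed
  qed
qed

lemma open_Baire_homeomorphic_map:
  assumes "homeomorphic_map X Y h" "open_Baire \<kappa> Y"
  shows "open_Baire \<kappa> X"
  unfolding open_Baire_def
proof (intro allI impI)
  fix P assume P: "openin X P \<and> P \<noteq> {}"
  have "homeomorphic_map (subtopology X (topspace X)) Y h" using assms(1) by simp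
  then show "Baire_in \<kappa> X P"
    using assms(2) P openin_subset by (intro Baire_in_open_chart[where N = "topspace X"]) auto
qed

section \<open>Products\<close>

text \<open>
  The Kuratowski--Ulam theorem for one nowhere dense set. For \<open>B\<close> in a \<open>\<pi>\<close>-base \<open>\<B>\<close> of \<open>Y\<close>, the set
  \<open>D B\<close> collects the points \<open>x\<close> at which the section of the closure of \<open>N\<close> contains \<open>B\<close>. If \<open>P \<times> B\<close>
  is shrunk to an open box that misses the closure, the first side of this box misses \<open>D B\<close>. A
  closed section that contains no member of \<open>\<B>\<close> is nowhere dense.
\<close>

lemma Kuratowski_Ulam_nowhere_dense:
  assumes \<B>: "\<forall>B\<in>\<B>. openin Y B \<and> B \<noteq> {}"
      "\<forall>Q. openin Y Q \<and> Q \<noteq> {} \<longrightarrow> (\<exists>B\<in>\<B>. B \<subseteq> Q)"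
    and N: "nowhere_dense_in (prod_topology X Y) N"
  defines "D \<equiv> \<lambda>B. {x \<in> topspace X. {x} \<times> B \<subseteq> prod_topology X Y closure_of N}"
  shows "B \<in> \<B> \<Longrightarrow> nowhere_dense_in X (D B)"
    and "x \<in> topspace X \<Longrightarrow> \<forall>B\<in>\<B>. x \<notin> D B \<Longrightarrow>
      nowhere_dense_in Y {y. (x, y) \<in> prod_topology X Y closure_of N}"
proof -
  let ?C = "prod_topology X Y closure_of N"
  show "nowhere_dense_in X (D B)" if B: "B \<in> \<B>"
    unfolding nowhere_dense_in_iff
  proof (intro conjI allI impI)
    show "D B \<subseteq> topspace X" by (auto simp: D_def)
    fix P assume P: "openin X P \<and> P \<noteq> {}"
    have "openin (prod_topology X Y) (P \<times> B)" "P \<times> B \<noteq> {}"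
      using P \<B>(1) B by (auto simp: openin_prod_Times_iff)
    then obtain Q where Q: "openin (prod_topology X Y) Q" "Q \<noteq> {}" "Q \<subseteq> P \<times> B" "Q \<inter> ?C = {}"
      using nowhere_dense_in_closure_of[OF N] unfolding nowhere_dense_in_iff by meson
    then obtain x y where xy: "(x, y) \<in> Q" by auto
    then obtain P' B' where PB: "openin X P'" "openin Y B'" "x \<in> P'" "y \<in> B'" "P' \<times> B' \<subseteq> Q"
      using Q(1) unfolding openin_prod_topology_alt by meson
    have "P' \<inter> D B = {}"
      using PB(4,5) Q(3,4) by (fastforce simp: D_def)
    moreover have "P' \<subseteq> P" using PB(4,5) Q(3) by blast
    ultimately show "\<exists>Q. openin X Q \<and> Q \<noteq> {} \<and> Q \<subseteq> P \<and> Q \<inter> D B = {}"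
      using PB(1,3) by blast
  qed
  show "nowhere_dense_in Y {y. (x, y) \<in> ?C}"
    if x: "x \<in> topspace X" and nD: "\<forall>B\<in>\<B>. x \<notin> D B"
    unfolding nowhere_dense_in_iff
  proof (intro conjI allI impI)
    have C_sub: "?C \<subseteq> topspace X \<times> topspace Y"
      using closure_of_subset_topspace[of "prod_topology X Y" N] by simp
    then show "{y. (x, y) \<in> ?C} \<subseteq> topspace Y" by blast
    fix Q assume Q: "openin Y Q \<and> Q \<noteq> {}"
    then obtain B where B: "B \<in> \<B>" "B \<subseteq> Q" using \<B>(2) by blast
    then obtain y where y: "y \<in> B" "(x, y) \<notin> ?C"
      using nD B(1) x by (auto simp: D_def)
    have yY: "y \<in> topspace Y" using y(1) \<B>(1) B(1) openin_subset by blast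
    have "openin (prod_topology X Y) (topspace (prod_topology X Y) - ?C)"
      by (intro openin_diff openin_topspace closedin_closure_of)
    moreover have "(x, y) \<in> topspace (prod_topology X Y) - ?C"
      using x yY y(2) by simp
    ultimately obtain P' B' where PB: "openin X P'" "openin Y B'" "x \<in> P'" "y \<in> B'"
        "P' \<times> B' \<subseteq> topspace (prod_topology X Y) - ?C"
      unfolding openin_prod_topology_alt by meson
    show "\<exists>R. openin Y R \<and> R \<noteq> {} \<and> R \<subseteq> Q \<and> R \<inter> {y. (x, y) \<in> ?C} = {}"
      using PB y(1) B \<B>(1) B(1) by (intro exI[of _ "B' \<inter> B"]) auto
  qed
qed

text \<open>
  Suppose fewer than \<open>\<kappa>\<close> nowhere dense sets cover a box \<open>V \<times> W\<close>. Each of them has countably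
  many exceptional sets \<open>D N B\<close>, so some \<open>x \<in> V\<close> lies in none of all these. The sections at \<open>x\<close> are then fewer
  than \<open>\<kappa>\<close> nowhere dense sets that cover \<open>W\<close>.
\<close>

lemma open_Baire_prod_topology:
  assumes \<kappa>: "omega1 \<le>o \<kappa>" and X: "open_Baire \<kappa> X" and Y: "open_Baire \<kappa> Y"
    and sc: "second_countable Y"
  shows "open_Baire \<kappa> (prod_topology X Y)"
  unfolding open_Baire_def
proof (intro allI impI)
  fix P assume P: "openin (prod_topology X Y) P \<and> P \<noteq> {}"
  then obtain a b where "(a, b) \<in> P" by auto
  then obtain V W where VW: "openin X V" "openin Y W" "a \<in> V" "b \<in> W" "V \<times> W \<subseteq> P"
    using P unfolding openin_prod_topology_alt by meson
  obtain \<B>0 where B0: "countable \<B>0" "\<And>B. B \<in> \<B>0 \<Longrightarrow> openin Y B"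
      "\<And>U x. openin Y U \<Longrightarrow> x \<in> U \<Longrightarrow> \<exists>B\<in>\<B>0. x \<in> B \<and> B \<subseteq> U"
    using sc unfolding second_countable_def by metis
  define \<B> where "\<B> = \<B>0 - {{}}"
  have \<B>: "countable \<B>" "\<forall>B\<in>\<B>. openin Y B \<and> B \<noteq> {}"
    using B0(1,2) by (auto simp: \<B>_def)
  have \<B>': "\<forall>Q. openin Y Q \<and> Q \<noteq> {} \<longrightarrow> (\<exists>B\<in>\<B>. B \<subseteq> Q)"
  proof (intro allI impI)
    fix Q assume Q: "openin Y Q \<and> Q \<noteq> {}"
    then obtain q where "q \<in> Q" by blast
    then obtain B where "B \<in> \<B>0" "q \<in> B" "B \<subseteq> Q" using B0(3) Q by metis
    then show "\<exists>B\<in>\<B>. B \<subseteq> Q" unfolding \<B>_def by blast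
  qed
  note KU = Kuratowski_Ulam_nowhere_dense[OF \<B>(2) \<B>']
  show "Baire_in \<kappa> (prod_topology X Y) P"
    unfolding Baire_in_def
  proof
    assume "\<exists>\<F>. |\<F>| <o \<kappa> \<and> (\<forall>N\<in>\<F>. nowhere_dense_in (prod_topology X Y) N) \<and> P \<subseteq> \<Union>\<F>"
    then obtain \<F> where F: "|\<F>| <o \<kappa>" "\<And>N. N \<in> \<F> \<Longrightarrow> nowhere_dense_in (prod_topology X Y) N"
        "P \<subseteq> \<Union>\<F>" by blast
    define D where "D N B = {x \<in> topspace X. {x} \<times> B \<subseteq> prod_topology X Y closure_of N}" for N B
    have "|\<Union>N\<in>\<F>. D N ` \<B>| <o \<kappa>"
      using \<kappa> F(1) \<B>(1) by (intro card_of_UN_countable_ordLess) auto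
    moreover have "nowhere_dense_in X E" if "E \<in> (\<Union>N\<in>\<F>. D N ` \<B>)" for E
      using that KU(1)[OF F(2)] unfolding D_def by blast
    moreover have "Baire_in \<kappa> X V" using X VW(1,3) unfolding open_Baire_def by blast
    ultimately have "\<not> V \<subseteq> \<Union>(\<Union>N\<in>\<F>. D N ` \<B>)"
      unfolding Baire_in_def by blast
    then obtain x where x: "x \<in> V" "\<And>N B. N \<in> \<F> \<Longrightarrow> B \<in> \<B> \<Longrightarrow> x \<notin> D N B" by blast
    have xX: "x \<in> topspace X" using x(1) VW(1) openin_subset by blast
    let ?G = "(\<lambda>N. {y. (x, y) \<in> prod_topology X Y closure_of N}) ` \<F>"
    have "|?G| <o \<kappa>" using card_of_image F(1) by (rule ordLeq_ordLess_trans)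
    moreover have "\<forall>E\<in>?G. nowhere_dense_in Y E"
      using KU(2)[OF F(2) xX] x(2) unfolding D_def by blast
    moreover have "W \<subseteq> \<Union>?G"
    proof
      fix y assume "y \<in> W"
      then have "(x, y) \<in> P" using x(1) VW(5) by blast
      then obtain N where N: "N \<in> \<F>" "(x, y) \<in> N" using F(3) by blast
      then have "N \<subseteq> prod_topology X Y closure_of N"
        using F(2) by (intro closure_of_subset) (auto simp: nowhere_dense_in_def)
      with N show "y \<in> \<Union>?G" by blast
    qed
    moreover have "Baire_in \<kappa> Y W" using Y VW(2,4) unfolding open_Baire_def by blast
    ultimately show False unfolding Baire_in_def by blast
  qed
qed

section \<open>Euclidean spaces\<close>

lemma second_countable_euclidean:
  "second_countable (euclidean :: 'a::second_countable_topology topology)"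
proof -
  obtain \<B> :: "'a set set" where "countable \<B>" "topological_basis \<B>"
    using ex_countable_basis by blast
  then show ?thesis
    unfolding second_countable_def open_openin[symmetric]
    by (intro exI[of _ \<B>]) (metis topological_basis_open topological_basisE)
qed

lemma second_countable_Euclidean_space: "second_countable (Euclidean_space n)"
  unfolding Euclidean_space_def euclidean_product_topology
  by (intro second_countable_subtopology second_countable_euclidean)

lemma continuous_map_Euclidean_space_coordinate:
  "continuous_map (Euclidean_space n) euclideanreal (\<lambda>x. x i)"
  unfolding Euclidean_space_def
  by (intro continuous_map_from_subtopology continuous_map_product_projection) auto

lemma continuous_map_into_Euclidean_space:
  assumes "\<And>i. continuous_map X euclideanreal (\<lambda>x. f x i)"
    and "\<And>x i. x \<in> topspace X \<Longrightarrow> n \<le> i \<Longrightarrow> f x i = 0"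
  shows "continuous_map X (Euclidean_space n) f"
  unfolding Euclidean_space_def continuous_map_in_subtopology continuous_map_componentwise_UNIV
  using assms by auto

lemma homeomorphic_map_Euclidean_space_Suc:
  "homeomorphic_map (Euclidean_space (Suc m)) (prod_topology (Euclidean_space m) euclideanreal)
     (\<lambda>x. (x(m := 0), x m))"
proof -
  have "homeomorphic_maps (Euclidean_space (Suc m)) (prod_topology (Euclidean_space m) euclideanreal)
     (\<lambda>x. (x(m := 0), x m)) (\<lambda>(x, t). x(m := t))"
    unfolding homeomorphic_maps_def
  proof (intro conjI)
    show "continuous_map (Euclidean_space (Suc m)) (prod_topology (Euclidean_space m) euclideanreal)
        (\<lambda>x. (x(m := 0), x m))"
    proof (intro continuous_map_pairedI continuous_map_into_Euclidean_space)
      show "continuous_map (Euclidean_space (Suc m)) euclideanreal (\<lambda>x. (x(m := 0)) i)" for i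
        by (cases "i = m") (simp_all add: continuous_map_Euclidean_space_coordinate)
    qed (auto simp: topspace_Euclidean_space continuous_map_Euclidean_space_coordinate)
    show "continuous_map (prod_topology (Euclidean_space m) euclideanreal) (Euclidean_space (Suc m))
        (\<lambda>(x, t). x(m := t))"
      unfolding case_prod_unfold
    proof (intro continuous_map_into_Euclidean_space)
      show "continuous_map (prod_topology (Euclidean_space m) euclideanreal) euclideanreal
          (\<lambda>p. ((fst p)(m := snd p)) i)" for i
      proof (cases "i = m")
        case False
        have "continuous_map (prod_topology (Euclidean_space m) euclideanreal) euclideanreal
            ((\<lambda>x. x i) \<circ> fst)"
          by (intro continuous_map_compose[OF continuous_map_fst]
                continuous_map_Euclidean_space_coordinate)
        with False show ?thesis by (simp add: o_def)
      qed (simp add: continuous_map_snd)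
    qed (auto simp: topspace_Euclidean_space)
  qed (auto simp: topspace_Euclidean_space)
  then show ?thesis by (rule homeomorphic_maps_imp_map)
qed

text \<open>
  Induction on the dimension. It starts at the one-point space, whose only nowhere dense subset is
  empty.
\<close>

lemma open_Baire_Euclidean_space:
  assumes "omega1 \<le>o \<kappa>" "open_Baire \<kappa> euclideanreal"
  shows "open_Baire \<kappa> (Euclidean_space m)"
proof (induction m)
  case 0
  let ?E = "Euclidean_space 0"
  have top: "topspace ?E = {\<lambda>i. 0}"
    by (auto simp: topspace_Euclidean_space)
  have empty: "N = {}" if N: "nowhere_dense_in ?E N" for N
  proof -
    have "openin ?E (topspace ?E) \<and> topspace ?E \<noteq> {}"
      using openin_topspace[of ?E] unfolding top by blast
    then obtain Q where Q: "openin ?E Q" "Q \<noteq> {}" "Q \<inter> N = {}"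
      using N unfolding nowhere_dense_in_iff by meson
    have "Q \<subseteq> {\<lambda>i. 0}" using openin_subset[OF Q(1)] top by simp
    moreover have "N \<subseteq> {\<lambda>i. 0}" using N top by (simp add: nowhere_dense_in_def)
    ultimately show ?thesis using Q(2,3) by auto
  qed
  show ?case
    unfolding open_Baire_def Baire_in_def
  proof (intro allI impI notI; elim exE conjE)
    fix P \<F>
    assume "P \<noteq> {}" "\<forall>N\<in>\<F>. nowhere_dense_in ?E N" "P \<subseteq> \<Union>\<F>"
    then show False using empty by blast
  qed
next
  case (Suc m)
  have "open_Baire \<kappa> (prod_topology (Euclidean_space m) euclideanreal)"
    using assms Suc.IH second_countable_euclidean by (intro open_Baire_prod_topology)
  then show ?case
    by (rule open_Baire_homeomorphic_map[OF homeomorphic_map_Euclidean_space_Suc])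
qed

lemma nowhere_dense_in_translation:
  fixes N :: "real set"
  assumes "nowhere_dense_in euclidean N"
  shows "nowhere_dense_in euclidean ((+) q ` N)"
  using assms unfolding nowhere_dense_in_def
  by (simp add: closure_translation interior_translation)

text \<open>
  Countably many translates of a nonempty open set cover the line, so a cover of the open set by
  nowhere dense sets gives a cover of the line by their rational translates.
\<close>

lemma open_Baire_real:
  assumes \<kappa>: "omega1 \<le>o \<kappa>" and R: "Baire_in \<kappa> euclideanreal UNIV"
  shows "open_Baire \<kappa> euclideanreal"
  unfolding open_Baire_def
proof (intro allI impI)
  fix P :: "real set" assume P: "openin euclidean P \<and> P \<noteq> {}"
  show "Baire_in \<kappa> euclidean P"
    unfolding Baire_in_def
  proof
    assume "\<exists>\<F>. |\<F>| <o \<kappa> \<and> (\<forall>N\<in>\<F>. nowhere_dense_in euclideanreal N) \<and> P \<subseteq> \<Union>\<F>"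
    then obtain \<F> where F: "|\<F>| <o \<kappa>" "\<And>N. N \<in> \<F> \<Longrightarrow> nowhere_dense_in euclideanreal N"
        "P \<subseteq> \<Union>\<F>" by blast
    let ?G = "\<Union>N\<in>\<F>. (\<lambda>q. (+) q ` N) ` \<rat>"
    have "|?G| <o \<kappa>"
      using \<kappa> F(1) countable_rat by (intro card_of_UN_countable_ordLess) auto
    moreover have "\<forall>N\<in>?G. nowhere_dense_in euclidean N"
      using F(2) nowhere_dense_in_translation by blast
    moreover have "UNIV \<subseteq> \<Union>?G"
    proof
      fix x :: real
      \<comment> \<open>A rational \<open>q\<close> of the form \<open>x - p\<close> with \<open>p \<in> P\<close> exhibits \<open>x\<close> in the translate of \<open>P\<close> by \<open>q\<close>.\<close>
      have "open ((\<lambda>p. x - p) ` P)" using P by (auto intro: open_neg_translation)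
      then obtain q where "q \<in> \<rat>" "q \<in> (\<lambda>p. x - p) ` P"
        using P Rats_closure_real open_Int_closure_eq_empty by blast
      then obtain p where p: "p \<in> P" "x = q + p" by auto
      then obtain N where "N \<in> \<F>" "p \<in> N" using F(3) by blast
      with p \<open>q \<in> \<rat>\<close> show "x \<in> \<Union>?G" by blast
    qed
    ultimately show False using R unfolding Baire_in_def by blast
  qed
qed

section \<open>The covering number of category\<close>

text \<open>
  An open set \<open>P\<close> of \<open>\<real>\<^sup>n\<close> meets each line parallel to the first axis in an open set, which can be
  shrunk to miss \<open>N\<close>; restricting the first coordinate accordingly shrinks \<open>P\<close>.
\<close>

lemma nowhere_dense_in_first_coordinate_preimage:
  assumes n: "n \<ge> 1" and N: "nowhere_dense_in euclideanreal N"
  shows "nowhere_dense_in (Euclidean_space n) {x \<in> topspace (Euclidean_space n). x 0 \<in> N}"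
  unfolding nowhere_dense_in_iff
proof (intro conjI allI impI)
  fix P assume P: "openin (Euclidean_space n) P \<and> P \<noteq> {}"
  then obtain x where x: "x \<in> P" by blast
  have xE: "x \<in> topspace (Euclidean_space n)" using P x openin_subset by blast
  have cont: "continuous_map euclideanreal (Euclidean_space n) (\<lambda>t. x(0 := t))"
    using xE n by (intro continuous_map_into_Euclidean_space) (auto simp: topspace_Euclidean_space fun_upd_def)
  define T where "T = {t. x(0 := t) \<in> P}"
  have "openin euclideanreal T"
    using openin_continuous_map_preimage[OF cont, of P] P by (simp add: T_def)
  moreover have "x 0 \<in> T" using x by (simp add: T_def)
  ultimately obtain Q where Q: "openin euclideanreal Q" "Q \<noteq> {}" "Q \<subseteq> T" "Q \<inter> N = {}"
    using N unfolding nowhere_dense_in_iff by blast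
  then obtain q where q: "q \<in> Q" by blast
  let ?R = "{y \<in> topspace (Euclidean_space n). y 0 \<in> Q} \<inter> P"
  have "openin (Euclidean_space n) ?R"
    using openin_continuous_map_preimage[OF continuous_map_Euclidean_space_coordinate Q(1)] P
    by auto
  moreover have "x(0 := q) \<in> ?R"
    using q Q(3) P openin_subset by (fastforce simp: T_def)
  moreover have "?R \<inter> {x \<in> topspace (Euclidean_space n). x 0 \<in> N} = {}" using Q(4) by blast
  ultimately show "\<exists>Q. openin (Euclidean_space n) Q \<and> Q \<noteq> {} \<and> Q \<subseteq> P \<and>
      Q \<inter> {x \<in> topspace (Euclidean_space n). x 0 \<in> N} = {}"
    by blast
qed auto

lemma Baire_in_cov_B_real:
  assumes n: "n \<ge> 1"
  shows "Baire_in (cov_B n) euclideanreal UNIV"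
  unfolding Baire_in_def
proof
  assume "\<exists>\<F>. |\<F>| <o cov_B n \<and> (\<forall>N\<in>\<F>. nowhere_dense_in euclideanreal N) \<and> UNIV \<subseteq> \<Union>\<F>"
  then obtain \<F> where F: "|\<F>| <o cov_B n" "\<And>N. N \<in> \<F> \<Longrightarrow> nowhere_dense_in euclideanreal N"
      "UNIV \<subseteq> \<Union>\<F>" by blast
  let ?G = "(\<lambda>N. {x \<in> topspace (Euclidean_space n). x 0 \<in> N}) ` \<F>"
  have "nowhere_dense_cover (Euclidean_space n) ?G"
    using F(2,3) nowhere_dense_in_first_coordinate_preimage[OF n]
    unfolding nowhere_dense_cover_def by blast
  then have "cov_B n \<le>o |?G|" by (rule cov_B_least(2)[OF n])
  also have "|?G| \<le>o |\<F>|" by (rule card_of_image)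
  finally (ordLeq_transitive) show False
    using F(1) not_ordLess_ordLeq by blast
qed

lemma Card_order_cov_B: "Card_order (cov_B n)"
  unfolding cov_B_def by (rule card_of_Card_order)

text \<open>
  Euclidean space is completely metrizable, so by the Baire category theorem no countable family of
  nowhere dense sets covers it.
\<close>

lemma omega1_le_cov_B:
  assumes n: "n \<ge> 1"
  shows "omega1 \<le>o cov_B n"
proof -
  let ?E = "Euclidean_space n"
  obtain \<F> where F: "nowhere_dense_cover ?E \<F>" "cov_B n = |\<F>|"
    using cov_B_least(1)[OF n] by blast
  have "uncountable \<F>"
  proof
    assume c: "countable \<F>"
    have "?E interior_of \<Union>((closure_of) ?E ` \<F>) = {}"
      using c F(1) completely_metrizable_Euclidean_space
      by (intro Baire_category_alt) (auto simp: nowhere_dense_cover_def nowhere_dense_in_def)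
    moreover have "topspace ?E \<subseteq> \<Union>((closure_of) ?E ` \<F>)"
    proof
      fix x assume "x \<in> topspace ?E"
      then obtain N where N: "N \<in> \<F>" "x \<in> N" using F(1) by (auto simp: nowhere_dense_cover_def)
      then have "N \<subseteq> ?E closure_of N"
        using F(1) by (intro closure_of_subset) (auto simp: nowhere_dense_cover_def)
      with N show "x \<in> \<Union>((closure_of) ?E ` \<F>)" by blast
    qed
    ultimately have "topspace ?E = {}"
      unfolding interior_of_eq_empty by blast
    then show False by (auto simp: topspace_Euclidean_space)
  qed
  then have "natLeq <o |\<F>|"
    by (simp add: countable_card_le_natLeq not_ordLeq_iff_ordLess natLeq_Well_order card_of_Well_order)
  then show ?thesis
    unfolding F(2) by (rule cardSuc_least[OF natLeq_Card_order card_of_Card_order])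
qed

section \<open>Manifolds\<close>

lemma second_countable_homeomorphic_space:
  assumes "X homeomorphic_space Y" "second_countable Y"
  shows "second_countable X"
proof -
  obtain f where "homeomorphic_map Y X f"
    using assms(1) homeomorphic_space homeomorphic_space_sym by blast
  then show ?thesis
    using second_countable_open_map_image[OF _ _ _ assms(2)]
    by (metis homeomorphic_eq_everything_map)
qed

lemma manifold_chart:
  assumes "manifold M" "x \<in> topspace M"
  obtains n V N where "openin M V" "x \<in> V" "V \<subseteq> N"
    "subtopology M N homeomorphic_space Euclidean_space n"
  using assms unfolding manifold_def by blast

lemma manifold_locally_Hausdorff_second_countable:
  assumes "manifold M" "x \<in> topspace M"
  shows "\<exists>V. open_Hausdorff_in M V \<and> x \<in> V \<and> second_countable (subtopology M V)"
proof -
  obtain n V N where V: "openin M V" "x \<in> V" "V \<subseteq> N"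
      and N: "subtopology M N homeomorphic_space Euclidean_space n"
    by (rule manifold_chart[OF assms])
  have eq: "subtopology M V = subtopology (subtopology M N) V"
    using V(3) by (simp add: subtopology_subtopology Int_absorb1)
  have "Hausdorff_space (subtopology M N)"
    using N Hausdorff_Euclidean_space homeomorphic_Hausdorff_space by blast
  moreover have "second_countable (subtopology M N)"
    using N second_countable_Euclidean_space by (rule second_countable_homeomorphic_space)
  ultimately have "Hausdorff_space (subtopology M V)" "second_countable (subtopology M V)"
    unfolding eq by (auto intro: Hausdorff_space_subtopology second_countable_subtopology)
  then show ?thesis
    using V(1,2) unfolding open_Hausdorff_in_def by blast
qed

text \<open>
  A scan inherits local second countability from the charts. If it were \<open>\<omega>\<^sub>1\<close>-Lindelof, it would be
  Lindelof and so be covered by countably many Hausdorff charts.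
\<close>

lemma scan_not_omega1_Lindelof:
  assumes "ENH_manifold M" and \<kappa>: "omega1 \<le>o \<kappa>"
    and A: "Baire_in \<kappa> M A" and S: "scan M A S"
  shows "\<not> omega1_Lindelof_space (subtopology M S)"
proof
  assume L: "omega1_Lindelof_space (subtopology M S)"
  have M: "manifold M" and NH: "\<And>x. x \<in> topspace M \<Longrightarrow> NH M x \<noteq> {}"
    using assms(1) by (auto simp: ENH_manifold_def)
  have SM: "S \<subseteq> topspace M"
    using S by (auto simp: scan_def NH_set_def NH_def)
  have "Lindelof_space (subtopology M S)"
  proof (rule omega1_Lindelof_imp_Lindelof_space[OF L])
    fix x assume x: "x \<in> topspace (subtopology M S)"
    then obtain V where V: "open_Hausdorff_in M V" "x \<in> V" "second_countable (subtopology M V)"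
      using manifold_locally_Hausdorff_second_countable[OF M] by auto
    have "subtopology (subtopology M S) (V \<inter> S) = subtopology (subtopology M V) (V \<inter> S)"
      by (simp add: subtopology_subtopology Int_left_commute Int_commute)
    then have "second_countable (subtopology (subtopology M S) (V \<inter> S))"
      using V(3) by (simp add: second_countable_subtopology)
    moreover have "openin (subtopology M S) (V \<inter> S)"
      using V(1) by (auto simp: open_Hausdorff_in_def openin_subtopology)
    ultimately show "\<exists>V. openin (subtopology M S) V \<and> x \<in> V \<and>
        second_countable (subtopology (subtopology M S) V)"
      using V(2) x by auto
  qed
  moreover have "\<forall>U\<in>{W \<inter> S | W. open_Hausdorff_in M W}. openin (subtopology M S) U"
    by (auto simp: open_Hausdorff_in_def openin_subtopology)
  moreover have "\<Union>{W \<inter> S | W. open_Hausdorff_in M W} = topspace (subtopology M S)"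
  proof
    show "topspace (subtopology M S) \<subseteq> \<Union>{W \<inter> S | W. open_Hausdorff_in M W}"
    proof
      fix x assume x: "x \<in> topspace (subtopology M S)"
      then obtain V where "open_Hausdorff_in M V" "x \<in> V"
        using manifold_locally_Hausdorff_second_countable[OF M] by auto
      then show "x \<in> \<Union>{W \<inter> S | W. open_Hausdorff_in M W}" using x by auto
    qed
  qed (use SM in auto)
  ultimately obtain \<V> where V: "countable \<V>" "\<V> \<subseteq> {W \<inter> S | W. open_Hausdorff_in M W}"
      "\<Union>\<V> = topspace (subtopology M S)"
    unfolding Lindelof_space_def by meson
  have "\<forall>V\<in>\<V>. \<exists>W. open_Hausdorff_in M W \<and> V \<subseteq> W" using V(2) by blast
  then obtain w where w: "\<And>V. V \<in> \<V> \<Longrightarrow> open_Hausdorff_in M (w V) \<and> V \<subseteq> w V" by metis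
  have "S \<subseteq> \<Union>(w ` \<V>)"
    using V(3) SM w by (fastforce simp: Int_absorb1)
  moreover have "|w ` \<V>| <o \<kappa>" using V(1) \<kappa> by (intro countable_ordLess) auto
  ultimately show False
    using scan_not_covered[OF NH A S, of "w ` \<V>"] w by blast
qed

text \<open>
  The dimension of the chart is unrelated to \<open>n\<close>: the line is \<open>cov_B n\<close>-Baire, and hence so are the
  nonempty open subsets of Euclidean spaces of every dimension.
\<close>

lemma Baire_in_cov_B_open_subset_manifold:
  assumes M: "manifold M" and U: "openin M U" "U \<noteq> {}" and n: "n \<ge> 1"
  shows "Baire_in (cov_B n) M U"
proof -
  obtain x where x: "x \<in> U" using U(2) by blast
  then have xM: "x \<in> topspace M" using U(1) openin_subset by blast
  obtain m V N where V: "openin M V" "x \<in> V" "V \<subseteq> N"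
      and N: "subtopology M N homeomorphic_space Euclidean_space m"
    by (rule manifold_chart[OF M xM])
  obtain h where h: "homeomorphic_map (subtopology M N) (Euclidean_space m) h"
    using N homeomorphic_space by blast
  have "open_Baire (cov_B n) (Euclidean_space m)"
    using omega1_le_cov_B[OF n] Baire_in_cov_B_real[OF n]
    by (intro open_Baire_Euclidean_space open_Baire_real)
  then have "Baire_in (cov_B n) M (U \<inter> V)"
    using h U(1) V x by (intro Baire_in_open_chart[OF h]) auto
  then show ?thesis by (rule Baire_in_mono) blast
qed

theorem corollary3p5:
  fixes M :: "'a topology" and U :: "'a set"
  assumes "ENH_manifold M" and "open_Hausdorff_in M U"
  shows "(\<forall>(\<kappa> :: 'k rel) A S.
            Card_order \<kappa> \<and> omega1 \<le>o \<kappa> \<and> A \<subseteq> U \<and> Baire_in \<kappa> M A \<and> scan M A S \<longrightarrow>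
              \<not> omega1_Lindelof_space (subtopology M S) \<and>
              \<not> (\<exists>\<W>. |\<W>| <o \<kappa> \<and> (\<forall>W\<in>\<W>. open_Hausdorff_in M W) \<and> S \<subseteq> \<Union>\<W>)) \<and>
         (U \<noteq> {} \<longrightarrow>
            (\<forall>n\<ge>1. Card_order (cov_B n) \<and> omega1 \<le>o cov_B n \<and> Baire_in (cov_B n) M U))"
proof (intro conjI allI impI; (elim conjE)?)
  fix \<kappa> :: "'k rel" and A S
  assume \<kappa>: "omega1 \<le>o \<kappa>" and A: "Baire_in \<kappa> M A" and S: "scan M A S"
  show "\<not> omega1_Lindelof_space (subtopology M S)"
    using scan_not_omega1_Lindelof[OF assms(1) \<kappa> A S] .
  show "\<not> (\<exists>\<W>. |\<W>| <o \<kappa> \<and> (\<forall>W\<in>\<W>. open_Hausdorff_in M W) \<and> S \<subseteq> \<Union>\<W>)"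
  proof
    assume "\<exists>\<W>. |\<W>| <o \<kappa> \<and> (\<forall>W\<in>\<W>. open_Hausdorff_in M W) \<and> S \<subseteq> \<Union>\<W>"
    then obtain \<W> where "|\<W>| <o \<kappa>" "\<And>W. W \<in> \<W> \<Longrightarrow> open_Hausdorff_in M W" "S \<subseteq> \<Union>\<W>"
      by blast
    moreover have "\<And>x. x \<in> topspace M \<Longrightarrow> NH M x \<noteq> {}"
      using assms(1) unfolding ENH_manifold_def by blast
    ultimately show False using scan_not_covered[OF _ A S] by blast
  qed
next
  fix n :: nat assume "U \<noteq> {}" and n: "1 \<le> n"
  show "Card_order (cov_B n)" by (rule Card_order_cov_B)
  show "omega1 \<le>o cov_B n" by (rule omega1_le_cov_B[OF n])
  show "Baire_in (cov_B n) M U"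
    using assms \<open>U \<noteq> {}\<close> n Baire_in_cov_B_open_subset_manifold
    unfolding ENH_manifold_def open_Hausdorff_in_def by blast
qed

end
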